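(* Let $X$ and $Y$ be sets, $0\in X$ a distinguished element, and $P$ a predicate on $X^\ast\times X\times Y$. Let $\mathcal{A}=(R,Q,E,\rho,\xi,\rhd)$ be an approximation algorithm of sort $X^\ast,X,Y$ which satisfies $P$, and let $\mathcal{A}_\omega$ be the algorithm constructed from $\mathcal{A}$ as described in the context. Then for all oracles $\phi_1:X^{\mathbb{N}}\to\mathbb{N}$ and $\phi_2:X^{\mathbb{N}}\to Y$: whenever an end state $\langle [\,],a \mid n,y\rangle$ (with $a\in X^\ast$, $n\in\mathbb{N}$, $y\in Y$) is reachable in $\mathcal{A}_\omega$ on $\phi_1,\phi_2$, we have $P(\overline{\alpha}n,\alpha_n,y)$ where $\alpha:=a::\mathbf{0}\in X^{\mathbb{N}}$.
   Context: Notation: for a set $Z$, $Z^\ast$ is the set of finite sequences over $Z$, $[\,]$ the empty sequence, $|a|$ the length of $a$, $a::z$ (resp. $a::b$) the extension of $a$ by the element $z$ (resp. the concatenation with $b$); for $\alpha\in Z^{\mathbb{N}}$, $\overline{\alpha}n:=[\alpha_0,\dots,\alpha_{n-1}]$; $\mathbf{0}$ is the constant sequence $0,0,\dots$, and $a::\mathbf{0}\in X^{\mathbb{N}}$. Approximation algorithm of sort $U,X,Y$: a tuple $(R,Q,E,\rho,\xi,\rhd)$ where $R$ is a set (registers); states are pairs $\langle r\mid o\rangle$ with $r\in R$ and $o\in Y\cup\{\Box\}$ ($\Box$ a fresh symbol, "empty answer"); $Q\subseteq\{\langle r\mid\Box\rangle: r\in R\}$ (query states); $E\subseteq\{\langle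 r\mid y\rangle : r\in R, y\in Y\}$ (end states) with $Q\cap E=\emptyset$; $\rho:U\to R$; $\xi:R\to X$; $\rhd$ is a partial function on states such that whenever $\rhd(\langle r\mid o\rangle)=\langle r'\mid y\rangle$ with $y\in Y$, then $o=y$ and $\xi(r)=\xi(r')$. For an oracle $f:X\to Y$, a run on $f$ is a finite sequence of states $s_0,\dots,s_m$ with $s_i\notin E$ for $i<m$, such that if $s_i=\langle r\mid\Box\rangle\in Q$ then $s_{i+1}=\langle r\mid f(\xi(r))\rangle$, and if $s_i\notin Q$ then $\rhd(s_i)$ is defined and equals $s_{i+1}$. Write $s\rhd^\ast_f t$ if there is a run on $f$ from $s$ to $t$. For $u\in U$ let $\rho_u:=\langle\rho(u)\mid\Box\rangle$. $\mathcal{A}$ satisfies $P$ if for all $u\in U$ and all $f:X\to Y$, $\rho_u\rhd^\ast_f\langle r\mid y\rangle\in E$ implies $P(u,\xi(r),y)$. Construction of $\mathcal{A}_\omega$ from $\mathcal{A}$ (sort $X^\ast,X,Y$): states are $\langle\sigma,a\mid o_1,o_2\rangle$ with $\sigma\in R^\ast$, $a\in X^\ast$, $o_1\in\mathbb{N}\cup\{\Box\}$, $o_2\in Y\cup\{\Box\}$. The initial state is $\langle[\rho([\,])],[\,]\mid\Box,\Box\rangle$. Query states of the first kind $Q_1$: states $\langle\sigma::r,[\,]\mid\Box,\Box\rangle$ with $\langle r\mid\Box\rangle\in Q$. Query states of the second kind $Q_2$: states $\langle\sigma,[\,]\mid n,\Box\rangle$ with $n\in\mathbb{N}$, $n<|\sigma|$.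 End states $E_\omega$: states $\langle[\,],a\mid n,y\rangle$ with $n\in\mathbb{N},y\in Y$. Let $\xi^\ast([r_0,\dots,r_{k-1}]):=[\xi(r_0),\dots,\xi(r_{k-1})]$ and $\xi_\omega(\sigma,a):=\xi^\ast(\sigma)::a::\mathbf{0}\in X^{\mathbb{N}}$. The transition partial function $\rhd_\omega$ is given by: (a) $\langle\sigma,[\,]\mid n,\Box\rangle\rhd_\omega\langle\sigma::\rho(\xi^\ast(\sigma)),[\,]\mid\Box,\Box\rangle$ for $n\in\mathbb{N}$; (b) $\langle\sigma::r,a\mid n,y\rangle\rhd_\omega\langle\sigma,\xi(r)::a\mid n,y\rangle$ if $\langle r\mid y\rangle\in E$; (c) otherwise: (i) $\langle\sigma::r,[\,]\mid\Box,\Box\rangle\rhd_\omega\langle\sigma::r',[\,]\mid\Box,\Box\rangle$ if $\rhd(\langle r\mid\Box\rangle)=\langle r'\mid\Box\rangle$; (ii) $\langle\sigma::r,a\mid n,y\rangle\rhd_\omega\langle\sigma::r',[\,]\mid\Box,\Box\rangle$ if $\rhd(\langle r\mid y\rangle)=\langle r'\mid\Box\rangle$; (iii) $\langle\sigma::r,a\mid n,y\rangle\rhd_\omega\langle\sigma::r',a\mid n,y\rangle$ if $\rhd(\langle r\mid y\rangle)=\langle r'\mid y\rangle$. Oracles are $\phi_1:X^{\mathbb{N}}\to\mathbb{N}$ and $\phi_2:X^{\mathbb{N}}\to Y$, with oracle transitions $\langle\sigma,a\mid\Box,\Box\rangle\mapsto\langle\sigma,a\mid\phi_1(\xi_\omega(\sigma,a)),\Box\rangle$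 from states in $Q_1$, and $\langle\sigma,a\mid n,\Box\rangle\mapsto\langle\sigma,a\mid n,\phi_2(\xi_\omega(\sigma,a))\rangle$ from states in $Q_2$. A run on $\phi_1,\phi_2$ is a finite sequence $s_0,\dots,s_m$ with $s_i\notin E_\omega$ for $i<m$, where $s_{i+1}$ is the oracle transition of $s_i$ if $s_i\in Q_1\cup Q_2$, and $s_{i+1}=\rhd_\omega(s_i)$ (defined) otherwise. A state is reachable if there is a run from the initial state to it. *)

theory Defs
  imports Main
begin

text \<open>
  The sets of registers, inputs and answers are types. In a pair \<open>(r, ans)\<close> or a tuple
  \<open>(\<sigma>, a, o1, o2)\<close>, the empty answer is \<^const>\<open>None\<close>. In lists of registers the most recently
  added element stands last, so the extension of \<open>\<sigma>\<close> by \<open>r\<close> is \<open>\<sigma> @ [r]\<close>.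
\<close>

type_synonym ('r, 'y) state = "'r \<times> 'y option"

record ('u, 'r, 'x, 'y) algorithm =
  Query :: "('r, 'y) state set"
  End :: "('r, 'y) state set"
  rho :: "'u \<Rightarrow> 'r"
  xi :: "'r \<Rightarrow> 'x"
  trans :: "('r, 'y) state \<Rightarrow> ('r, 'y) state option"

definition approximation_algorithm :: "('u, 'r, 'x, 'y) algorithm \<Rightarrow> bool" where
  "approximation_algorithm A \<longleftrightarrow>
     Query A \<subseteq> {(r, None) | r. True} \<and>
     End A \<subseteq> {(r, Some y) | r y. True} \<and>
     Query A \<inter> End A = {} \<and>
     (\<forall>r ans r' y. trans A (r, ans) = Some (r', Some y) \<longrightarrow> ans = Some y \<and> xi A r = xi A r')"

definition is_run ::
  "('u, 'r, 'x, 'y) algorithm \<Rightarrow> ('x \<Rightarrow> 'y) \<Rightarrow> ('r, 'y) state list \<Rightarrow> bool" where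
  "is_run A f ss \<longleftrightarrow> ss \<noteq> [] \<and>
     (\<forall>i. Suc i < length ss \<longrightarrow>
        ss ! i \<notin> End A \<and>
        (if ss ! i \<in> Query A
         then ss ! Suc i = (fst (ss ! i), Some (f (xi A (fst (ss ! i)))))
         else trans A (ss ! i) = Some (ss ! Suc i)))"

definition reaches ::
  "('u, 'r, 'x, 'y) algorithm \<Rightarrow> ('x \<Rightarrow> 'y) \<Rightarrow> ('r, 'y) state \<Rightarrow> ('r, 'y) state \<Rightarrow> bool" where
  "reaches A f s t \<longleftrightarrow> (\<exists>ss. is_run A f ss \<and> hd ss = s \<and> last ss = t)"

definition satisfies ::
  "('u, 'r, 'x, 'y) algorithm \<Rightarrow> ('u \<Rightarrow> 'x \<Rightarrow> 'y \<Rightarrow> bool) \<Rightarrow> bool" where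
  "satisfies A P \<longleftrightarrow>
     (\<forall>u f r y. reaches A f (rho A u, None) (r, Some y) \<and> (r, Some y) \<in> End A
        \<longrightarrow> P u (xi A r) y)"

definition extend_const :: "'x \<Rightarrow> 'x list \<Rightarrow> nat \<Rightarrow> 'x" where
  "extend_const z a = (\<lambda>i. if i < length a then a ! i else z)"

definition initial_segment :: "(nat \<Rightarrow> 'x) \<Rightarrow> nat \<Rightarrow> 'x list" where
  "initial_segment \<alpha> n = map \<alpha> [0..<n]"

type_synonym ('r, 'x, 'y) omega_state = "'r list \<times> 'x list \<times> nat option \<times> 'y option"

definition omega_init :: "('x list, 'r, 'x, 'y) algorithm \<Rightarrow> ('r, 'x, 'y) omega_state" where
  "omega_init A = ([rho A []], [], None, None)"

definition omega_Query1 :: "('x list, 'r, 'x, 'y) algorithm \<Rightarrow> ('r, 'x, 'y) omega_state set" where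
  "omega_Query1 A = {(\<sigma> @ [r], [], None, None) | \<sigma> r. (r, None) \<in> Query A}"

definition omega_Query2 :: "('r, 'x, 'y) omega_state set" where
  "omega_Query2 = {(\<sigma>, [], Some n, None) | \<sigma> n. n < length \<sigma>}"

definition omega_End :: "('r, 'x, 'y) omega_state set" where
  "omega_End = {([], a, Some n, Some y) | a n y. True}"

definition omega_xi ::
  "'x \<Rightarrow> ('x list, 'r, 'x, 'y) algorithm \<Rightarrow> 'r list \<Rightarrow> 'x list \<Rightarrow> nat \<Rightarrow> 'x" where
  "omega_xi z A \<sigma> a = extend_const z (map (xi A) \<sigma> @ a)"

text \<open>
  The partial transition function, given as its graph; it is single-valued by
  \<open>omega_trans_functional\<close> below. In \<open>c_i\<close> the proviso ``otherwise'' is void, since no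
  earlier clause applies to states whose two answers are both empty.
\<close>

inductive omega_trans ::
  "('x list, 'r, 'x, 'y) algorithm \<Rightarrow> ('r, 'x, 'y) omega_state \<Rightarrow> ('r, 'x, 'y) omega_state \<Rightarrow> bool"
  for A where
  a: "omega_trans A (\<sigma>, [], Some n, None) (\<sigma> @ [rho A (map (xi A) \<sigma>)], [], None, None)"
| b: "(r, Some y) \<in> End A \<Longrightarrow>
      omega_trans A (\<sigma> @ [r], a, Some n, Some y) (\<sigma>, xi A r # a, Some n, Some y)"
| c_i: "trans A (r, None) = Some (r', None) \<Longrightarrow>
      omega_trans A (\<sigma> @ [r], [], None, None) (\<sigma> @ [r'], [], None, None)"
| c_ii: "(r, Some y) \<notin> End A \<Longrightarrow> trans A (r, Some y) = Some (r', None) \<Longrightarrow>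
      omega_trans A (\<sigma> @ [r], a, Some n, Some y) (\<sigma> @ [r'], [], None, None)"
| c_iii: "(r, Some y) \<notin> End A \<Longrightarrow> trans A (r, Some y) = Some (r', Some y) \<Longrightarrow>
      omega_trans A (\<sigma> @ [r], a, Some n, Some y) (\<sigma> @ [r'], a, Some n, Some y)"

lemma omega_trans_functional:
  "omega_trans A s t \<Longrightarrow> omega_trans A s t' \<Longrightarrow> t = t'"
  by (elim omega_trans.cases) auto

text \<open>
  Queries take precedence over transitions: clause \<open>a\<close> is also defined on second-kind query
  states, but a run applies it only when \<open>n \<ge> length \<sigma>\<close>.
\<close>

definition omega_is_run ::
  "'x \<Rightarrow> ('x list, 'r, 'x, 'y) algorithm \<Rightarrow> ((nat \<Rightarrow> 'x) \<Rightarrow> nat) \<Rightarrow> ((nat \<Rightarrow> 'x) \<Rightarrow> 'y) \<Rightarrow>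
     ('r, 'x, 'y) omega_state list \<Rightarrow> bool" where
  "omega_is_run z A \<phi>1 \<phi>2 ss \<longleftrightarrow> ss \<noteq> [] \<and>
     (\<forall>i. Suc i < length ss \<longrightarrow>
        ss ! i \<notin> omega_End \<and>
        (case ss ! i of (\<sigma>, a, o1, o2) \<Rightarrow>
           if ss ! i \<in> omega_Query1 A
           then ss ! Suc i = (\<sigma>, a, Some (\<phi>1 (omega_xi z A \<sigma> a)), o2)
           else if ss ! i \<in> omega_Query2
           then ss ! Suc i = (\<sigma>, a, o1, Some (\<phi>2 (omega_xi z A \<sigma> a)))
           else omega_trans A (ss ! i) (ss ! Suc i)))"

definition omega_reachable ::
  "'x \<Rightarrow> ('x list, 'r, 'x, 'y) algorithm \<Rightarrow> ((nat \<Rightarrow> 'x) \<Rightarrow> nat) \<Rightarrow> ((nat \<Rightarrow> 'x) \<Rightarrow> 'y) \<Rightarrow>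
     ('r, 'x, 'y) omega_state \<Rightarrow> bool" where
  "omega_reachable z A \<phi>1 \<phi>2 t \<longleftrightarrow>
     (\<exists>ss. omega_is_run z A \<phi>1 \<phi>2 ss \<and> hd ss = omega_init A \<and> last ss = t)"

end

theory Submission
  imports Defs
begin

text \<open>
  The level of the stack above \<open>\<sigma>\<close> simulates a run of \<open>A\<close> on the argument \<open>\<tau> = map (xi A) \<sigma>\<close>. A
  query \<open>x\<close> of that run is answered either by \<open>\<phi>2\<close> or by the final answer of a new level for
  \<open>\<tau> @ [x]\<close>. This answer depends on \<open>\<tau>\<close> and \<open>x\<close> alone, so repeated queries get equal answers and
  each level is a genuine run of \<open>A\<close> on a single function \<open>X \<Rightarrow> Y\<close>. In a state
  \<open>(\<sigma>, a, Some n, Some y)\<close> with \<open>n \<ge> length \<sigma>\<close>, the sequence \<open>\<alpha> = omega_xi z A \<sigma> a\<close> then satisfies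
  \<open>P (initial_segment \<alpha> n) (\<alpha> n) y\<close>: this arises when a level of height \<open>n\<close> ends, because \<open>A\<close>
  satisfies \<open>P\<close>, and is kept when lower levels end, because ending a level does not change \<open>\<alpha>\<close>.
\<close>

section \<open>Runs and induction along them\<close>

lemma reaches_refl: "reaches A f s s"
  unfolding reaches_def is_run_def by (rule exI[of _ "[s]"]) simp

lemma reaches_snoc:
  assumes "reaches A f s t" and "t \<notin> End A"
    and "if t \<in> Query A then t' = (fst t, Some (f (xi A (fst t)))) else trans A t = Some t'"
  shows "reaches A f s t'"
proof -
  obtain ss where ss: "is_run A f ss" "hd ss = s" "last ss = t"
    using assms(1) unfolding reaches_def by blast
  have ne: "ss \<noteq> []" using ss(1) unfolding is_run_def by blast
  have "is_run A f (ss @ [t'])"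
    unfolding is_run_def
  proof (rule conjI[OF _ allI[OF impI]])
    fix i assume "Suc i < length (ss @ [t'])"
    then consider "Suc i < length ss" | "Suc i = length ss" by fastforce
    then show "(ss @ [t']) ! i \<notin> End A \<and>
      (if (ss @ [t']) ! i \<in> Query A
       then (ss @ [t']) ! Suc i =
         (fst ((ss @ [t']) ! i), Some (f (xi A (fst ((ss @ [t']) ! i)))))
       else trans A ((ss @ [t']) ! i) = Some ((ss @ [t']) ! Suc i))"
    proof cases
      case 1
      then show ?thesis using ss(1) unfolding is_run_def by (auto simp: nth_append)
    next
      case 2
      then have "i = length ss - 1" by simp
      then have "i < length ss" "ss ! i = t" using ss(3) ne by (simp_all add: last_conv_nth)
      then have "(ss @ [t']) ! i = t" "(ss @ [t']) ! Suc i = t'"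
        using 2 by (simp_all add: nth_append)
      then show ?thesis using assms(2,3) by (simp only: simp_thms)
    qed
  qed simp
  then show ?thesis
    unfolding reaches_def using ss(2) ne by (intro exI[of _ "ss @ [t']"]) simp
qed

definition omega_step ::
  "'x \<Rightarrow> ('x list, 'r, 'x, 'y) algorithm \<Rightarrow> ((nat \<Rightarrow> 'x) \<Rightarrow> nat) \<Rightarrow> ((nat \<Rightarrow> 'x) \<Rightarrow> 'y) \<Rightarrow>
     ('r, 'x, 'y) omega_state \<Rightarrow> ('r, 'x, 'y) omega_state \<Rightarrow> bool" where
  "omega_step z A \<phi>1 \<phi>2 s t \<longleftrightarrow> s \<notin> omega_End \<and>
     (case s of (\<sigma>, a, o1, o2) \<Rightarrow>
        if s \<in> omega_Query1 A then t = (\<sigma>, a, Some (\<phi>1 (omega_xi z A \<sigma> a)), o2)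
        else if s \<in> omega_Query2 then t = (\<sigma>, a, o1, Some (\<phi>2 (omega_xi z A \<sigma> a)))
        else omega_trans A s t)"

lemma omega_reachable_induct:
  assumes "omega_reachable z A \<phi>1 \<phi>2 t"
    and init: "I (omega_init A)"
    and step: "\<And>s s'. I s \<Longrightarrow> omega_step z A \<phi>1 \<phi>2 s s' \<Longrightarrow> I s'"
  shows "I t"
proof -
  obtain ss where ss: "omega_is_run z A \<phi>1 \<phi>2 ss" "hd ss = omega_init A" "last ss = t"
    using assms(1) unfolding omega_reachable_def by blast
  have ne: "ss \<noteq> []" using ss(1) unfolding omega_is_run_def by blast
  have "i < length ss \<Longrightarrow> I (ss ! i)" for i
  proof (induction i)
    case 0
    then show ?case using init ss(2) ne by (simp add: hd_conv_nth)
  next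
    case (Suc i)
    have "omega_step z A \<phi>1 \<phi>2 (ss ! i) (ss ! Suc i)"
      using ss(1) Suc.prems unfolding omega_is_run_def omega_step_def by simp
    then show ?case using Suc step by simp
  qed
  from this[of "length ss - 1"] show ?thesis using ss(3) ne by (simp add: last_conv_nth)
qed

lemma initial_segment_extend_const:
  "initial_segment (extend_const z (a @ b)) (length a) = a"
  unfolding initial_segment_def extend_const_def by (rule nth_equalityI) (auto simp: nth_append)

lemma extend_const_nth: "extend_const z (a @ x # b) (length a) = x"
  unfolding extend_const_def by simp

section \<open>The function on which each level is a run\<close>

locale omega_simulation =
  fixes A :: "('x list, 'r, 'x, 'y) algorithm"
    and z :: 'x
    and \<phi>1 :: "(nat \<Rightarrow> 'x) \<Rightarrow> nat" and \<phi>2 :: "(nat \<Rightarrow> 'x) \<Rightarrow> 'y"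
  assumes algorithm: "approximation_algorithm A"
begin

lemma Query_None: "(r, ans) \<in> Query A \<Longrightarrow> ans = None"
  and End_Some: "(r, None) \<notin> End A"
  and trans_Some: "trans A (r, ans) = Some (r', Some y) \<Longrightarrow> ans = Some y \<and> xi A r = xi A r'"
  using algorithm unfolding approximation_algorithm_def by blast+

abbreviation asks :: "'x list \<Rightarrow> bool" where
  "asks \<tau> \<equiv> \<phi>1 (extend_const z \<tau>) < length \<tau>"

text \<open>
  \<open>yields \<tau> s y\<close>: a level for the argument \<open>\<tau>\<close>, currently in the state \<open>s\<close>, ends with the answer \<open>y\<close>.
\<close>

inductive yields :: "'x list \<Rightarrow> ('r, 'y) state \<Rightarrow> 'y \<Rightarrow> bool" where
  ended: "(r, Some y) \<in> End A \<Longrightarrow> yields \<tau> (r, Some y) y"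
| asked: "(r, None) \<in> Query A \<Longrightarrow> asks (\<tau> @ [xi A r]) \<Longrightarrow>
    yields \<tau> (r, Some (\<phi>2 (extend_const z (\<tau> @ [xi A r])))) y \<Longrightarrow> yields \<tau> (r, None) y"
| nested: "(r, None) \<in> Query A \<Longrightarrow> \<not> asks (\<tau> @ [xi A r]) \<Longrightarrow>
    yields (\<tau> @ [xi A r]) (rho A (\<tau> @ [xi A r]), None) y' \<Longrightarrow>
    yields \<tau> (r, Some y') y \<Longrightarrow> yields \<tau> (r, None) y"
| stepped: "s \<notin> Query A \<Longrightarrow> s \<notin> End A \<Longrightarrow> trans A s = Some s' \<Longrightarrow>
    yields \<tau> s' y \<Longrightarrow> yields \<tau> s y"

text \<open>At most one rule applies to a state: end states carry an answer, query states do not,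
  and \<open>asks\<close> separates \<open>asked\<close> from \<open>nested\<close>. In
  \<open>nested\<close> the inner answers have to be identified first.\<close>

lemma yields_functional: "yields \<tau> s y \<Longrightarrow> yields \<tau> s y' \<Longrightarrow> y = y'"
proof (induction arbitrary: y' rule: yields.induct)
  case (ended r y \<tau>)
  from ended(2,1) show ?case by cases auto
next
  case (asked r \<tau> y)
  from asked(5,1,2) show ?case by cases (auto dest: asked.IH)
next
  case (nested r \<tau> y1 y)
  from nested(7,1,2) show ?case
  proof cases
    case (nested y2)
    then show ?thesis using "nested.IH" by metis
  qed auto
next
  case (stepped s s' \<tau> y)
  from stepped(6,1-3) show ?case by cases (auto dest: stepped.IH)
qed

text \<open>An oracle has to be total. If the level for \<open>\<tau>'\<close> yields no answer,
  \<open>SOME\<close> picks an arbitrary value; this does no harm, since \<open>reply_nested\<close>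
  is invoked only once an answer has been derived.\<close>

definition reply :: "'x list \<Rightarrow> 'x \<Rightarrow> 'y" where
  "reply \<tau> x = (let \<tau>' = \<tau> @ [x] in
     if asks \<tau>' then \<phi>2 (extend_const z \<tau>') else SOME y. yields \<tau>' (rho A \<tau>', None) y)"

lemma reply_asked: "asks (\<tau> @ [x]) \<Longrightarrow> reply \<tau> x = \<phi>2 (extend_const z (\<tau> @ [x]))"
  unfolding reply_def Let_def by simp

lemma reply_nested:
  assumes "\<not> asks (\<tau> @ [x])" and "yields (\<tau> @ [x]) (rho A (\<tau> @ [x]), None) y"
  shows "reply \<tau> x = y"
proof -
  have "(SOME y. yields (\<tau> @ [x]) (rho A (\<tau> @ [x]), None) y) = y"
    using assms(2) yields_functional by (blast intro: some_equality)
  then show ?thesis using assms(1) unfolding reply_def Let_def by argo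
qed

text \<open>
  The second conjunct carries the answer of a level that ends back to its start, where \<^const>\<open>reply\<close>
  looks it up.
\<close>

definition level :: "'x list \<Rightarrow> ('r, 'y) state \<Rightarrow> bool" where
  "level \<tau> s \<longleftrightarrow> reaches A (reply \<tau>) (rho A \<tau>, None) s \<and>
     (\<forall>y. yields \<tau> s y \<longrightarrow> yields \<tau> (rho A \<tau>, None) y)"

lemma level_init: "level \<tau> (rho A \<tau>, None)"
  unfolding level_def by (simp add: reaches_refl)

lemma level_step:
  assumes "level \<tau> s" "s \<notin> Query A" "s \<notin> End A" "trans A s = Some s'"
  shows "level \<tau> s'"
  using assms reaches_snoc[of A "reply \<tau>" _ s s'] yields.stepped[of s s' \<tau>]
  unfolding level_def by auto

lemma level_asked:
  assumes "level \<tau> (r, None)" "(r, None) \<in> Query A" "asks (\<tau> @ [xi A r])"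
  shows "level \<tau> (r, Some (\<phi>2 (extend_const z (\<tau> @ [xi A r]))))"
  using assms reaches_snoc[of A "reply \<tau>" _ "(r, None)"] yields.asked[of r \<tau>]
  unfolding level_def by (auto simp: End_Some reply_asked)

text \<open>Answers are unique, so the answer of the nested level is the value of
  \<open>reply \<tau>\<close> at this query, and it continues the run on that oracle.\<close>

lemma level_nested:
  assumes "level \<tau> (r, None)" "(r, None) \<in> Query A" "\<not> asks (\<tau> @ [xi A r])"
    and "yields (\<tau> @ [xi A r]) (rho A (\<tau> @ [xi A r]), None) y"
  shows "level \<tau> (r, Some y)"
  using assms reaches_snoc[of A "reply \<tau>" _ "(r, None)"] yields.nested[of r \<tau> y]
    reply_nested[of \<tau> "xi A r" y]
  unfolding level_def by (auto simp: End_Some)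

lemma level_ended:
  assumes "level \<tau> (r, Some y)" "(r, Some y) \<in> End A"
  shows "yields \<tau> (rho A \<tau>, None) y"
  using assms unfolding level_def by (blast intro: yields.ended)

text \<open>\<open>satisfies\<close> quantifies over all oracles, in particular over
  \<open>reply \<tau>\<close>.\<close>

lemma level_satisfies:
  assumes "level \<tau> (r, Some y)" "(r, Some y) \<in> End A" "satisfies A P"
  shows "P \<tau> (xi A r) y"
  using assms unfolding level_def satisfies_def by blast

section \<open>The invariant of the stack\<close>

text \<open>Describes the part of the stack below its top: each register is suspended at a query
  that the level above it is to answer.\<close>

inductive pending :: "'r list \<Rightarrow> bool" where
  Nil: "pending []"
| snoc: "pending \<sigma> \<Longrightarrow> level (map (xi A) \<sigma>) (r, None) \<Longrightarrow> (r, None) \<in> Query A \<Longrightarrow>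
    \<not> asks (map (xi A) \<sigma> @ [xi A r]) \<Longrightarrow> pending (\<sigma> @ [r])"

definition correct ::
  "('x list \<Rightarrow> 'x \<Rightarrow> 'y \<Rightarrow> bool) \<Rightarrow> (nat \<Rightarrow> 'x) \<Rightarrow> nat \<Rightarrow> 'y \<Rightarrow> bool" where
  "correct P \<alpha> n y \<longleftrightarrow> P (initial_segment \<alpha> n) (\<alpha> n) y"

text \<open>In \<open>answered\<close> the bound \<open>length \<sigma> < n\<close> is strict
  because the stack is \<open>\<sigma> @ [r]\<close>: correctness at index
  \<open>length \<sigma>\<close> is established only when the top level ends.\<close>

inductive invariant ::
  "('x list \<Rightarrow> 'x \<Rightarrow> 'y \<Rightarrow> bool) \<Rightarrow> ('r, 'x, 'y) omega_state \<Rightarrow> bool"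
  for P where
  running: "pending \<sigma> \<Longrightarrow> level (map (xi A) \<sigma>) (r, None) \<Longrightarrow>
    invariant P (\<sigma> @ [r], [], None, None)"
| querying: "pending \<sigma> \<Longrightarrow> level (map (xi A) \<sigma>) (r, None) \<Longrightarrow> (r, None) \<in> Query A \<Longrightarrow>
    invariant P (\<sigma> @ [r], [], Some (\<phi>1 (omega_xi z A (\<sigma> @ [r]) [])), None)"
| answered: "pending \<sigma> \<Longrightarrow> level (map (xi A) \<sigma>) (r, Some y) \<Longrightarrow>
    (length \<sigma> < n \<Longrightarrow> correct P (omega_xi z A (\<sigma> @ [r]) a) n y) \<Longrightarrow>
    invariant P (\<sigma> @ [r], a, Some n, Some y)"
| finished: "correct P (extend_const z a) n y \<Longrightarrow> invariant P ([], a, Some n, Some y)"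

lemma omega_xi_snoc: "omega_xi z A (\<sigma> @ [r]) a = omega_xi z A \<sigma> (xi A r # a)"
  unfolding omega_xi_def by simp

lemma invariant_init: "invariant P (omega_init A)"
  using invariant.running[OF pending.Nil] level_init[of "[]"] unfolding omega_init_def by simp

lemma invariant_pop:
  assumes "satisfies A P" "pending \<sigma>" "level (map (xi A) \<sigma>) (r, Some y)" "(r, Some y) \<in> End A"
    and above: "length \<sigma> < n \<Longrightarrow> correct P (omega_xi z A (\<sigma> @ [r]) a) n y"
  shows "invariant P (\<sigma>, xi A r # a, Some n, Some y)"
proof -
  have here: "correct P (omega_xi z A (\<sigma> @ [r]) a) (length \<sigma>) y"
    using level_satisfies[OF assms(3,4,1)] unfolding correct_def omega_xi_snoc omega_xi_def
    using initial_segment_extend_const[of z "map (xi A) \<sigma>" "xi A r # a"]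
      extend_const_nth[of z "map (xi A) \<sigma>" "xi A r" a]
    by simp
  \<comment> \<open>Index \<open>length \<sigma>\<close> is settled by the level that ends here,
    larger ones by \<open>above\<close>.\<close>
  have *: "correct P (omega_xi z A \<sigma> (xi A r # a)) n y" if "length \<sigma> \<le> n"
    using here above that unfolding omega_xi_snoc by (cases "length \<sigma> = n") auto
  from assms(2) show ?thesis
  proof cases
    case Nil
    then show ?thesis using * by (auto simp: omega_xi_def intro: invariant.finished)
  next
    case (snoc \<sigma>' r')
    have "level (map (xi A) \<sigma>') (r', Some y)"
      using level_nested[OF snoc(3-5)] level_ended[OF assms(3,4)] snoc(1) by simp
    \<comment> \<open>The bound \<open>length \<sigma>' < n\<close> needed for
      \<open>answered\<close> is the same as \<open>length \<sigma> \<le> n\<close>.\<close>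
    then show ?thesis using * snoc(1,2) by (auto intro: invariant.answered)
  qed
qed

lemma invariant_step:
  assumes "satisfies A P" "invariant P s" "omega_step z A \<phi>1 \<phi>2 s t"
  shows "invariant P t"
  using assms(2)
proof cases
  case (running \<sigma> r)
  show ?thesis
  proof (cases "(r, None) \<in> Query A")
    case True
    then have "t = (\<sigma> @ [r], [], Some (\<phi>1 (omega_xi z A (\<sigma> @ [r]) [])), None)"
      using assms(3) running(1) unfolding omega_step_def omega_Query1_def by auto
    then show ?thesis using invariant.querying[OF running(2,3) True] by simp
  next
    case False
    then have "omega_trans A (\<sigma> @ [r], [], None, None) t"
      using assms(3) running(1) unfolding omega_step_def omega_Query1_def omega_Query2_def by auto
    then obtain r' where r': "trans A (r, None) = Some (r', None)" "t = (\<sigma> @ [r'], [], None, None)"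
      by cases auto
    then show ?thesis
      using invariant.running[OF running(2)] level_step[OF running(3) False End_Some] by simp
  qed
next
  case (querying \<sigma> r)
  let ?\<tau> = "map (xi A) \<sigma> @ [xi A r]"
  have xi: "omega_xi z A (\<sigma> @ [r]) [] = extend_const z ?\<tau>" unfolding omega_xi_def by simp
  show ?thesis
  proof (cases "asks ?\<tau>")
    case True
    then have "t = (\<sigma> @ [r], [], Some (\<phi>1 (extend_const z ?\<tau>)), Some (\<phi>2 (extend_const z ?\<tau>)))"
      using assms(3) querying(1) xi unfolding omega_step_def omega_Query1_def omega_Query2_def by auto
    \<comment> \<open>\<open>asks\<close> compares with \<open>length \<sigma> + 1\<close>, so the
      correctness premise of \<open>answered\<close> is vacuous.\<close>
    moreover have "\<not> length \<sigma> < \<phi>1 (extend_const z ?\<tau>)" using True by simp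
    ultimately show ?thesis
      using invariant.answered[OF querying(2) level_asked[OF querying(3,4) True]] by blast
  next
    case False
    then have "omega_trans A (\<sigma> @ [r], [], Some (\<phi>1 (extend_const z ?\<tau>)), None) t"
      using assms(3) querying(1) xi unfolding omega_step_def omega_Query1_def omega_Query2_def by auto
    \<comment> \<open>The value of \<open>\<phi>1\<close> is too large for a query of the second
      kind, so clause \<open>a\<close> opens a new level and \<open>r\<close> becomes
      pending.\<close>
    then have "t = ((\<sigma> @ [r]) @ [rho A (map (xi A) (\<sigma> @ [r]))], [], None, None)"
      by cases auto
    then show ?thesis
      using invariant.running[OF pending.snoc[OF querying(2-4) False]] level_init by blast
  qed
next
  case (answered \<sigma> r y n a)
  have not_Query: "(r, Some y) \<notin> Query A" using Query_None by blast
  have "omega_trans A (\<sigma> @ [r], a, Some n, Some y) t"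
    using assms(3) answered(1) unfolding omega_step_def omega_Query1_def omega_Query2_def by auto
  then show ?thesis
  proof cases
    case b
    then show ?thesis using invariant_pop[OF assms(1) answered(2,3) _ answered(4)] by simp
  next
    case (c_ii _ r')
    \<comment> \<open>Both answers and \<open>a\<close> are discarded, so no correctness claim has
      to be carried on.\<close>
    then show ?thesis
      using invariant.running[OF answered(2)] level_step[OF answered(3) not_Query] by simp
  next
    case (c_iii _ r')
    \<comment> \<open>A transition into a state with an answer preserves \<open>xi\<close>, hence
      the whole sequence.\<close>
    then have "omega_xi z A (\<sigma> @ [r']) a = omega_xi z A (\<sigma> @ [r]) a"
      using trans_Some[of r "Some y" r' y] unfolding omega_xi_def by simp
    then show ?thesis
      using c_iii invariant.answered[OF answered(2)] level_step[OF answered(3) not_Query] answered(4)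
      by simp
  qed
next
  case finished
  then show ?thesis using assms(3) unfolding omega_step_def omega_End_def by auto
qed

end

theorem theorem5p10:
  fixes A :: "('x list, 'r, 'x, 'y) algorithm"
    and P :: "'x list \<Rightarrow> 'x \<Rightarrow> 'y \<Rightarrow> bool"
    and z :: 'x
    and \<phi>1 :: "(nat \<Rightarrow> 'x) \<Rightarrow> nat" and \<phi>2 :: "(nat \<Rightarrow> 'x) \<Rightarrow> 'y"
    and a :: "'x list" and n :: nat and y :: 'y
  assumes "approximation_algorithm A"
    and "satisfies A P"
    and "([], a, Some n, Some y) \<in> omega_End"
    and "omega_reachable z A \<phi>1 \<phi>2 ([], a, Some n, Some y)"
  shows "let \<alpha> = extend_const z a in P (initial_segment \<alpha> n) (\<alpha> n) y"
proof -
  interpret omega_simulation A z \<phi>1 \<phi>2 using assms(1) by unfold_locales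
  have "invariant P ([], a, Some n, Some y)"
    using assms(4) invariant_init invariant_step[OF assms(2)] by (rule omega_reachable_induct)
  \<comment> \<open>With an empty stack only \<open>finished\<close> applies, and its premise is the
    claim.\<close>
  then show ?thesis by cases (auto simp: correct_def Let_def)
qed

end
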